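(* For every natural number $k$ and every formula $\varphi$: (1) if $\mathrm{PNF}(\varphi) \cap \Sigma_k^+ \neq \emptyset$, then $\varphi \in \mathrm{E}_k^+$; (2) if $\mathrm{PNF}(\varphi) \cap \Pi_k^+ \neq \emptyset$, then $\varphi \in \mathrm{U}_k^+$.
   Context: Fix an arbitrary first-order language whose logical symbols are $\forall, \exists, \to, \land, \lor, \perp$. $\mathrm{FV}(\varphi)$ is the set of free variables of $\varphi$. Prenex classes: $\Sigma_0 = \Pi_0$ is the class of quantifier-free formulas; $\Sigma_{k+1}$ is the class of formulas $\exists x_1 \cdots \exists x_n \varphi$ with $n \geq 1$ and $\varphi \in \Pi_k$; $\Pi_{k+1}$ is the class of formulas $\forall x_1 \cdots \forall x_n \varphi$ with $n\ge 1$ and $\varphi \in \Sigma_k$. $\Sigma_k^+ = \Sigma_k \cup \bigcup_{i<k}(\Sigma_i \cup \Pi_i)$, $\Pi_k^+ = \Pi_k \cup \bigcup_{i<k}(\Sigma_i \cup \Pi_i)$. A formula is in prenex normal form if it is in $\Sigma_k \cup \Pi_k$ for some $k$. Alternation paths: finite sequences of $+$ and $-$ in which $+$ and $-$ alternate. For such $s$, $i(s)$ is its first symbol if $s$ is nonempty and a special symbol $\times$ if $s=\langle\,\rangle$; $s^\perp$ swaps $+$ and $-$; $l(s)$ is its length; $+s$, $-s$ denote prepending. $\mathrm{Alt}(\varphi)$: if $\varphi$ is quantifier-free, $\{\langle\,\rangle\}$; otherwise $\mathrm{Alt}(\varphi_1 \land \varphi_2)=\mathrm{Alt}(\varphi_1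 \lor \varphi_2) = \mathrm{Alt}(\varphi_1)\cup\mathrm{Alt}(\varphi_2)$; $\mathrm{Alt}(\varphi_1\to\varphi_2) = \{s^\perp : s\in\mathrm{Alt}(\varphi_1)\}\cup\mathrm{Alt}(\varphi_2)$; $\mathrm{Alt}(\forall x\varphi_1) = \{s\in\mathrm{Alt}(\varphi_1): i(s)=-\}\cup\{-s: s\in\mathrm{Alt}(\varphi_1), i(s)\neq -\}$; $\mathrm{Alt}(\exists x\varphi_1) = \{s\in\mathrm{Alt}(\varphi_1): i(s)=+\}\cup\{+s: s\in\mathrm{Alt}(\varphi_1), i(s)\neq +\}$. $\deg(\varphi)=\max\{l(s): s\in\mathrm{Alt}(\varphi)\}$. Classes: $\mathrm{F}_k=\{\varphi:\deg(\varphi)=k\}$; $\mathrm{U}_0=\mathrm{E}_0=\mathrm{F}_0$; $\mathrm{U}_{k+1}=\{\varphi\in\mathrm{F}_{k+1}: i(s)=- \text{ for all } s\in\mathrm{Alt}(\varphi) \text{ with } l(s)=k+1\}$; $\mathrm{E}_{k+1}$ likewise with $+$; $\mathrm{U}_k^+=\mathrm{U}_k\cup\bigcup_{i<k}\mathrm{F}_i$; $\mathrm{E}_k^+=\mathrm{E}_k\cup\bigcup_{i<k}\mathrm{F}_i$. Prenex transformation: $\varphi\rhd\psi$ means that for some formulas $\xi,\delta$, a variable $x\notin\mathrm{FV}(\delta)$, a variable $y$ not occurring in $\xi$, and $Q\in\{\forall,\exists\}$, $(\varphi,\psi)$ is one of: $(\exists x\xi(x)\to\delta, \forall x(\xi(x)\to\delta))$;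 $(\forall x\xi(x)\to\delta, \exists x(\xi(x)\to\delta))$; $(\delta\to Qx\,\xi(x), Qx(\delta\to\xi(x)))$; $(Qx\,\xi(x)\land\delta, Qx(\xi(x)\land\delta))$; $(\delta\land Qx\,\xi(x), Qx(\delta\land\xi(x)))$; $(Qx\,\xi(x)\lor\delta, Qx(\xi(x)\lor\delta))$; $(\delta\lor Qx\,\xi(x), Qx(\delta\lor\xi(x)))$; $(Qx\,\xi(x), Qy\,\xi(y))$, with $\xi(y)$ the substitution of $y$ for free $x$. $\varphi\rhd^*\psi$ means there are $m\ge0$ and $\varphi_0\equiv\varphi,\dots,\varphi_m\equiv\psi$ with each $\varphi_{i+1}$ obtained from $\varphi_i$ by replacing one occurrence of a subformula $\xi_i$ with $\delta_i$ where $\xi_i\rhd\delta_i$. $\mathrm{PNF}(\varphi)=\{\psi:\varphi\rhd^*\psi \text{ and } \psi \text{ is in prenex normal form}\}$. *)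

theory Defs
  imports Main
begin

datatype 'f tm = Var nat | Fn 'f "'f tm list"

datatype ('f, 'p) fm =
    Bot
  | Pred 'p "'f tm list"
  | Imp "('f, 'p) fm" "('f, 'p) fm"
  | Conj "('f, 'p) fm" "('f, 'p) fm"
  | Disj "('f, 'p) fm" "('f, 'p) fm"
  | All nat "('f, 'p) fm"
  | Exi nat "('f, 'p) fm"

text \<open>
  A language is a set of function symbols (constants have arity 0) and a set of predicate symbols,
  each symbol with an arity. Either set may be empty, which the type variables alone
  would not allow. Equality, if present, is one of the predicate symbols.
\<close>

record ('f, 'p) language =
  fun_syms :: "'f set"
  fun_arity :: "'f \<Rightarrow> nat"
  pred_syms :: "'p set"
  pred_arity :: "'p \<Rightarrow> nat"

primrec tm_in :: "('f, 'p) language \<Rightarrow> 'f tm \<Rightarrow> bool" where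
  "tm_in L (Var x) \<longleftrightarrow> True"
| "tm_in L (Fn f ts) \<longleftrightarrow>
     f \<in> fun_syms L \<and> length ts = fun_arity L f \<and> (\<forall>b \<in> set (map (tm_in L) ts). b)"

primrec fm_in :: "('f, 'p) language \<Rightarrow> ('f, 'p) fm \<Rightarrow> bool" where
  "fm_in L Bot \<longleftrightarrow> True"
| "fm_in L (Pred p ts) \<longleftrightarrow>
     p \<in> pred_syms L \<and> length ts = pred_arity L p \<and> (\<forall>t \<in> set ts. tm_in L t)"
| "fm_in L (Imp \<phi> \<psi>) \<longleftrightarrow> fm_in L \<phi> \<and> fm_in L \<psi>"
| "fm_in L (Conj \<phi> \<psi>) \<longleftrightarrow> fm_in L \<phi> \<and> fm_in L \<psi>"
| "fm_in L (Disj \<phi> \<psi>) \<longleftrightarrow> fm_in L \<phi> \<and> fm_in L \<psi>"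
| "fm_in L (All x \<phi>) \<longleftrightarrow> fm_in L \<phi>"
| "fm_in L (Exi x \<phi>) \<longleftrightarrow> fm_in L \<phi>"

definition formulas :: "('f, 'p) language \<Rightarrow> ('f, 'p) fm set" where
  "formulas L = {\<phi>. fm_in L \<phi>}"

primrec vars_tm :: "'f tm \<Rightarrow> nat set" where
  "vars_tm (Var x) = {x}"
| "vars_tm (Fn f ts) = \<Union> (set (map vars_tm ts))"

primrec FV :: "('f, 'p) fm \<Rightarrow> nat set" where
  "FV Bot = {}"
| "FV (Pred p ts) = (\<Union>t\<in>set ts. vars_tm t)"
| "FV (Imp \<phi> \<psi>) = FV \<phi> \<union> FV \<psi>"
| "FV (Conj \<phi> \<psi>) = FV \<phi> \<union> FV \<psi>"
| "FV (Disj \<phi> \<psi>) = FV \<phi> \<union> FV \<psi>"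
| "FV (All x \<phi>) = FV \<phi> - {x}"
| "FV (Exi x \<phi>) = FV \<phi> - {x}"

text \<open>All variables occurring in a formula: free, bound, or attached to a quantifier.\<close>

primrec occ :: "('f, 'p) fm \<Rightarrow> nat set" where
  "occ Bot = {}"
| "occ (Pred p ts) = (\<Union>t\<in>set ts. vars_tm t)"
| "occ (Imp \<phi> \<psi>) = occ \<phi> \<union> occ \<psi>"
| "occ (Conj \<phi> \<psi>) = occ \<phi> \<union> occ \<psi>"
| "occ (Disj \<phi> \<psi>) = occ \<phi> \<union> occ \<psi>"
| "occ (All x \<phi>) = insert x (occ \<phi>)"
| "occ (Exi x \<phi>) = insert x (occ \<phi>)"

primrec subst_tm :: "nat \<Rightarrow> nat \<Rightarrow> 'f tm \<Rightarrow> 'f tm" where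
  "subst_tm x y (Var z) = Var (if z = x then y else z)"
| "subst_tm x y (Fn f ts) = Fn f (map (subst_tm x y) ts)"

text \<open>
  \<^term>\<open>subst x y \<phi>\<close> replaces the free occurrences of \<^term>\<open>x\<close> by \<^term>\<open>y\<close>. It does not rename
  bound variables; it is only used when \<^term>\<open>y\<close> does not occur in \<^term>\<open>\<phi>\<close>, so nothing is captured.
\<close>

primrec subst :: "nat \<Rightarrow> nat \<Rightarrow> ('f, 'p) fm \<Rightarrow> ('f, 'p) fm" where
  "subst x y Bot = Bot"
| "subst x y (Pred p ts) = Pred p (map (subst_tm x y) ts)"
| "subst x y (Imp \<phi> \<psi>) = Imp (subst x y \<phi>) (subst x y \<psi>)"
| "subst x y (Conj \<phi> \<psi>) = Conj (subst x y \<phi>) (subst x y \<psi>)"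
| "subst x y (Disj \<phi> \<psi>) = Disj (subst x y \<phi>) (subst x y \<psi>)"
| "subst x y (All z \<phi>) = All z (if z = x then \<phi> else subst x y \<phi>)"
| "subst x y (Exi z \<phi>) = Exi z (if z = x then \<phi> else subst x y \<phi>)"

primrec qfree :: "('f, 'p) fm \<Rightarrow> bool" where
  "qfree Bot \<longleftrightarrow> True"
| "qfree (Pred p ts) \<longleftrightarrow> True"
| "qfree (Imp \<phi> \<psi>) \<longleftrightarrow> qfree \<phi> \<and> qfree \<psi>"
| "qfree (Conj \<phi> \<psi>) \<longleftrightarrow> qfree \<phi> \<and> qfree \<psi>"
| "qfree (Disj \<phi> \<psi>) \<longleftrightarrow> qfree \<phi> \<and> qfree \<psi>"
| "qfree (All x \<phi>) \<longleftrightarrow> False"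
| "qfree (Exi x \<phi>) \<longleftrightarrow> False"


section \<open>Prenex classes\<close>

fun Sigma_fm :: "nat \<Rightarrow> ('f, 'p) fm set" and Pi_fm :: "nat \<Rightarrow> ('f, 'p) fm set" where
  "Sigma_fm 0 = {\<phi>. qfree \<phi>}"
| "Sigma_fm (Suc k) = {foldr Exi xs \<phi> | xs \<phi>. xs \<noteq> [] \<and> \<phi> \<in> Pi_fm k}"
| "Pi_fm 0 = {\<phi>. qfree \<phi>}"
| "Pi_fm (Suc k) = {foldr All xs \<phi> | xs \<phi>. xs \<noteq> [] \<and> \<phi> \<in> Sigma_fm k}"

definition Sigma_plus :: "nat \<Rightarrow> ('f, 'p) fm set" where
  "Sigma_plus k = Sigma_fm k \<union> (\<Union>i<k. Sigma_fm i \<union> Pi_fm i)"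

definition Pi_plus :: "nat \<Rightarrow> ('f, 'p) fm set" where
  "Pi_plus k = Pi_fm k \<union> (\<Union>i<k. Sigma_fm i \<union> Pi_fm i)"

definition prenex :: "('f, 'p) fm \<Rightarrow> bool" where
  "prenex \<phi> \<longleftrightarrow> (\<exists>k. \<phi> \<in> Sigma_fm k \<union> Pi_fm k)"


section \<open>Alternation paths\<close>

datatype sign = Plus | Minus

primrec flip :: "sign \<Rightarrow> sign" where
  "flip Plus = Minus"
| "flip Minus = Plus"

definition alternating :: "sign list \<Rightarrow> bool" where
  "alternating s \<longleftrightarrow> (\<forall>i. Suc i < length s \<longrightarrow> s ! i \<noteq> s ! Suc i)"

definition perp :: "sign list \<Rightarrow> sign list" where
  "perp s = map flip s"

text \<open>\<^term>\<open>None\<close> plays the role of the special symbol assigned to the empty path.\<close>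

definition init :: "sign list \<Rightarrow> sign option" where
  "init s = (case s of [] \<Rightarrow> None | a # _ \<Rightarrow> Some a)"

primrec Alt :: "('f, 'p) fm \<Rightarrow> sign list set" where
  "Alt Bot = {[]}"
| "Alt (Pred p ts) = {[]}"
| "Alt (Imp \<phi> \<psi>) = (if qfree (Imp \<phi> \<psi>) then {[]} else perp ` Alt \<phi> \<union> Alt \<psi>)"
| "Alt (Conj \<phi> \<psi>) = (if qfree (Conj \<phi> \<psi>) then {[]} else Alt \<phi> \<union> Alt \<psi>)"
| "Alt (Disj \<phi> \<psi>) = (if qfree (Disj \<phi> \<psi>) then {[]} else Alt \<phi> \<union> Alt \<psi>)"
| "Alt (All x \<phi>) = {s \<in> Alt \<phi>. init s = Some Minus}
                  \<union> {Minus # s | s. s \<in> Alt \<phi> \<and> init s \<noteq> Some Minus}"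
| "Alt (Exi x \<phi>) = {s \<in> Alt \<phi>. init s = Some Plus}
                  \<union> {Plus # s | s. s \<in> Alt \<phi> \<and> init s \<noteq> Some Plus}"

lemma finite_Alt: "finite (Alt \<phi>)"
  by (induction \<phi>) auto

lemma Alt_nonempty: "Alt \<phi> \<noteq> {}"
proof (induction \<phi>)
  case (All x \<phi>)
  then obtain s where "s \<in> Alt \<phi>" by blast
  then show ?case by (cases "init s = Some Minus") auto
next
  case (Exi x \<phi>)
  then obtain s where "s \<in> Alt \<phi>" by blast
  then show ?case by (cases "init s = Some Plus") auto
qed auto

lemma alternating_Cons:
  assumes "alternating s" and "init s \<noteq> Some a"
  shows "alternating (a # s)"
  unfolding alternating_def
proof (intro allI impI)
  fix i
  assume "Suc i < length (a # s)"
  then show "(a # s) ! i \<noteq> (a # s) ! Suc i"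
    using assms by (cases i; cases s) (auto simp: alternating_def init_def)
qed

lemma alternating_perp:
  assumes "alternating s"
  shows "alternating (perp s)"
proof -
  have "flip a = flip b \<longleftrightarrow> a = b" for a b
    by (cases a; cases b) auto
  then show ?thesis
    using assms by (auto simp: alternating_def perp_def)
qed

lemma Alt_alternating: "s \<in> Alt \<phi> \<Longrightarrow> alternating s"
proof -
  have empty: "alternating []"
    by (simp add: alternating_def)
  show "s \<in> Alt \<phi> \<Longrightarrow> alternating s"
    by (induction \<phi> arbitrary: s)
      (auto simp: alternating_Cons alternating_perp empty split: if_splits)
qed

definition deg :: "('f, 'p) fm \<Rightarrow> nat" where
  "deg \<phi> = Max (length ` Alt \<phi>)"

definition F_cls :: "nat \<Rightarrow> ('f, 'p) fm set" where
  "F_cls k = {\<phi>. deg \<phi> = k}"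

primrec U_cls :: "nat \<Rightarrow> ('f, 'p) fm set" where
  "U_cls 0 = F_cls 0"
| "U_cls (Suc k) =
     {\<phi> \<in> F_cls (Suc k). \<forall>s \<in> Alt \<phi>. length s = Suc k \<longrightarrow> init s = Some Minus}"

primrec E_cls :: "nat \<Rightarrow> ('f, 'p) fm set" where
  "E_cls 0 = F_cls 0"
| "E_cls (Suc k) =
     {\<phi> \<in> F_cls (Suc k). \<forall>s \<in> Alt \<phi>. length s = Suc k \<longrightarrow> init s = Some Plus}"

definition U_plus :: "nat \<Rightarrow> ('f, 'p) fm set" where
  "U_plus k = U_cls k \<union> (\<Union>i<k. F_cls i)"

definition E_plus :: "nat \<Rightarrow> ('f, 'p) fm set" where
  "E_plus k = E_cls k \<union> (\<Union>i<k. F_cls i)"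


section \<open>Prenex transformation\<close>

inductive rhd :: "('f, 'p) fm \<Rightarrow> ('f, 'p) fm \<Rightarrow> bool" (infix "\<rhd>" 50) where
  exi_imp: "x \<notin> FV \<delta> \<Longrightarrow> Imp (Exi x \<xi>) \<delta> \<rhd> All x (Imp \<xi> \<delta>)"
| all_imp: "x \<notin> FV \<delta> \<Longrightarrow> Imp (All x \<xi>) \<delta> \<rhd> Exi x (Imp \<xi> \<delta>)"
| imp_Q: "Q \<in> {All, Exi} \<Longrightarrow> x \<notin> FV \<delta> \<Longrightarrow> Imp \<delta> (Q x \<xi>) \<rhd> Q x (Imp \<delta> \<xi>)"
| Q_conj: "Q \<in> {All, Exi} \<Longrightarrow> x \<notin> FV \<delta> \<Longrightarrow> Conj (Q x \<xi>) \<delta> \<rhd> Q x (Conj \<xi> \<delta>)"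
| conj_Q: "Q \<in> {All, Exi} \<Longrightarrow> x \<notin> FV \<delta> \<Longrightarrow> Conj \<delta> (Q x \<xi>) \<rhd> Q x (Conj \<delta> \<xi>)"
| Q_disj: "Q \<in> {All, Exi} \<Longrightarrow> x \<notin> FV \<delta> \<Longrightarrow> Disj (Q x \<xi>) \<delta> \<rhd> Q x (Disj \<xi> \<delta>)"
| disj_Q: "Q \<in> {All, Exi} \<Longrightarrow> x \<notin> FV \<delta> \<Longrightarrow> Disj \<delta> (Q x \<xi>) \<rhd> Q x (Disj \<delta> \<xi>)"
| rename: "Q \<in> {All, Exi} \<Longrightarrow> y \<notin> occ \<xi> \<Longrightarrow> Q x \<xi> \<rhd> Q y (subst x y \<xi>)"

text \<open>Replacement of exactly one occurrence of a subformula.\<close>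

inductive step :: "('f, 'p) fm \<Rightarrow> ('f, 'p) fm \<Rightarrow> bool" where
  here: "\<phi> \<rhd> \<psi> \<Longrightarrow> step \<phi> \<psi>"
| imp_l: "step \<phi> \<psi> \<Longrightarrow> step (Imp \<phi> \<chi>) (Imp \<psi> \<chi>)"
| imp_r: "step \<phi> \<psi> \<Longrightarrow> step (Imp \<chi> \<phi>) (Imp \<chi> \<psi>)"
| conj_l: "step \<phi> \<psi> \<Longrightarrow> step (Conj \<phi> \<chi>) (Conj \<psi> \<chi>)"
| conj_r: "step \<phi> \<psi> \<Longrightarrow> step (Conj \<chi> \<phi>) (Conj \<chi> \<psi>)"
| disj_l: "step \<phi> \<psi> \<Longrightarrow> step (Disj \<phi> \<chi>) (Disj \<psi> \<chi>)"
| disj_r: "step \<phi> \<psi> \<Longrightarrow> step (Disj \<chi> \<phi>) (Disj \<chi> \<psi>)"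
| all: "step \<phi> \<psi> \<Longrightarrow> step (All x \<phi>) (All x \<psi>)"
| exi: "step \<phi> \<psi> \<Longrightarrow> step (Exi x \<phi>) (Exi x \<psi>)"

definition PNF :: "('f, 'p) fm \<Rightarrow> ('f, 'p) fm set" where
  "PNF \<phi> = {\<psi>. step\<^sup>*\<^sup>* \<phi> \<psi> \<and> prenex \<psi>}"

text \<open>
  The transformation never leaves the language of the formula it starts from, so \<^const>\<open>PNF\<close>
  needs no language parameter.
\<close>

lemma tm_in_subst: "tm_in L (subst_tm x y t) = tm_in L t"
  by (induction t) (auto)

lemma fm_in_subst: "fm_in L (subst x y \<phi>) = fm_in L \<phi>"
  by (induction \<phi>) (auto simp: tm_in_subst)

lemma fm_in_rhd: "\<phi> \<rhd> \<psi> \<Longrightarrow> fm_in L \<psi> = fm_in L \<phi>"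
  by (induction rule: rhd.induct) (auto simp: fm_in_subst)

lemma fm_in_step: "step \<phi> \<psi> \<Longrightarrow> fm_in L \<psi> = fm_in L \<phi>"
  by (induction rule: step.induct) (auto simp: fm_in_rhd)

lemma PNF_in_formulas:
  assumes "\<phi> \<in> formulas L"
  shows "PNF \<phi> \<subseteq> formulas L"
proof
  fix \<psi>
  assume "\<psi> \<in> PNF \<phi>"
  then have "step\<^sup>*\<^sup>* \<phi> \<psi>"
    by (simp add: PNF_def)
  then show "\<psi> \<in> formulas L"
    using assms by (induction rule: rtranclp_induct) (simp_all add: formulas_def fm_in_step)
qed

end

theory Submission
  imports Defs
begin

text \<open>
  Compare alternation paths first by length and, for equal length, only with paths having the same
  first symbol. Adding a quantifier, dualizing and taking unions are monotone for this preorder, so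
  a prenex step, which at worst moves a quantifier outwards over the paths of a side formula, can
  only increase the set of alternation paths. A prenex formula has a single alternation path, which
  starts with its outermost quantifier; membership in the classes \<open>E_plus k\<close> and \<open>U_plus k\<close> is a
  downward closed condition on paths and thus is inherited from the prenex form.
\<close>

definition prepend :: "sign \<Rightarrow> sign list \<Rightarrow> sign list" where
  "prepend a s = (if init s = Some a then s else a # s)"

definition path_le :: "sign list \<Rightarrow> sign list \<Rightarrow> bool" where
  "path_le s t \<longleftrightarrow> length s < length t \<or> length s = length t \<and> init s = init t"

text \<open>The lower (Hoare) extension of a preorder to sets: enough to transport upper bounds back
  from \<open>B\<close> to \<open>A\<close>.\<close>

definition paths_le :: "sign list set \<Rightarrow> sign list set \<Rightarrow> bool" where
  "paths_le A B \<longleftrightarrow> (\<forall>s\<in>A. \<exists>t\<in>B. path_le s t)"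

text \<open>The disjunct \<open>s = []\<close> serves \<open>k = 0\<close>, where the classes put no
  condition on the first symbol.\<close>

definition path_bounded :: "sign \<Rightarrow> nat \<Rightarrow> sign list \<Rightarrow> bool" where
  "path_bounded a k s \<longleftrightarrow> length s < k \<or> length s = k \<and> (s = [] \<or> init s = Some a)"

lemma init_Nil [simp]: "init [] = None"
  by (simp add: init_def)

lemma init_Cons [simp]: "init (a # s) = Some a"
  by (simp add: init_def)

lemma perp_Nil [simp]: "perp [] = []"
  by (simp add: perp_def)

lemma length_perp [simp]: "length (perp s) = length s"
  by (simp add: perp_def)

lemma init_perp: "init (perp s) = map_option flip (init s)"
  by (simp add: perp_def init_def split: list.split)

lemma flip_eq_iff [simp]: "flip a = flip b \<longleftrightarrow> a = b"
  by (cases a; cases b) auto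

lemma perp_prepend: "perp (prepend a s) = prepend (flip a) (perp s)"
  by (cases s) (auto simp: prepend_def perp_def)

lemma prepend_idem [simp]: "prepend a (prepend a s) = prepend a s"
  by (simp add: prepend_def)

lemma path_le_refl: "path_le s s"
  by (simp add: path_le_def)

lemma path_le_trans: "path_le s t \<Longrightarrow> path_le t u \<Longrightarrow> path_le s u"
  by (auto simp: path_le_def)

lemma path_le_prepend: "path_le s (prepend a s)"
  by (simp add: path_le_def prepend_def)

text \<open>Dualizing preserves the order instead of reversing it: lengths stay, and equal first
  symbols stay equal. So the antecedent of an implication needs no separate contravariant
  treatment.\<close>

lemma path_le_perp: "path_le s t \<Longrightarrow> path_le (perp s) (perp t)"
  by (auto simp: path_le_def init_perp)

text \<open>The critical case is a shorter \<open>s\<close> that grows while \<open>t\<close>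
  already starts with \<open>a\<close>: if the lengths become equal, both paths now start with
  \<open>a\<close>.\<close>

lemma prepend_mono: "path_le s t \<Longrightarrow> path_le (prepend a s) (prepend a t)"
  by (auto simp: path_le_def prepend_def)

lemma path_bounded_downward: "path_le s t \<Longrightarrow> path_bounded a k t \<Longrightarrow> path_bounded a k s"
  by (auto simp: path_le_def path_bounded_def)

lemma paths_le_refl: "paths_le A A"
  using path_le_refl by (auto simp: paths_le_def)

lemma paths_le_trans: "paths_le A B \<Longrightarrow> paths_le B C \<Longrightarrow> paths_le A C"
  unfolding paths_le_def by (meson path_le_trans)

lemma paths_le_Un: "paths_le A A' \<Longrightarrow> paths_le B B' \<Longrightarrow> paths_le (A \<union> B) (A' \<union> B')"
  by (auto simp: paths_le_def)

lemma paths_le_perp: "paths_le A B \<Longrightarrow> paths_le (perp ` A) (perp ` B)"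
  unfolding paths_le_def by (blast intro: path_le_perp)

lemma paths_le_prepend_mono: "paths_le A B \<Longrightarrow> paths_le (prepend a ` A) (prepend a ` B)"
  unfolding paths_le_def by (blast intro: prepend_mono)

lemma paths_le_prepend: "paths_le A (prepend a ` A)"
  using path_le_prepend by (auto simp: paths_le_def)

text \<open>With \<open>f\<close> = \<open>perp\<close> this covers a side formula standing in the
  antecedent of an implication.\<close>

lemma paths_le_prepend_image: "paths_le (f ` A) ((\<lambda>s. prepend a (f s)) ` A)"
  using path_le_prepend by (auto simp: paths_le_def)

lemma Alt_qfree: "qfree \<phi> \<Longrightarrow> Alt \<phi> = {[]}"
  by (induction \<phi>) auto

text \<open>The exception for quantifier-free formulas disappears, since there the general clause
  also yields \<open>{[]}\<close>.\<close>

lemma Alt_Imp: "Alt (Imp \<phi> \<psi>) = perp ` Alt \<phi> \<union> Alt \<psi>"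
  by (auto simp: Alt_qfree)

lemma Alt_Conj: "Alt (Conj \<phi> \<psi>) = Alt \<phi> \<union> Alt \<psi>"
  by (auto simp: Alt_qfree)

lemma Alt_Disj: "Alt (Disj \<phi> \<psi>) = Alt \<phi> \<union> Alt \<psi>"
  by (auto simp: Alt_qfree)

lemma prepend_image:
  "prepend a ` A = {s \<in> A. init s = Some a} \<union> {a # s | s. s \<in> A \<and> init s \<noteq> Some a}"
  by (auto simp: prepend_def)

lemma Alt_All: "Alt (All x \<phi>) = prepend Minus ` Alt \<phi>"
  by (simp add: prepend_image)

lemma Alt_Exi: "Alt (Exi x \<phi>) = prepend Plus ` Alt \<phi>"
  by (simp add: prepend_image)

lemmas Alt_simps = Alt_Imp Alt_Conj Alt_Disj Alt_All Alt_Exi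

declare Alt.simps(3-7) [simp del]

text \<open>Paths depend only on connectives and quantifiers, never on terms, so renaming keeps
  them.\<close>

lemma Alt_subst [simp]: "Alt (subst x y \<phi>) = Alt \<phi>"
  by (induction \<phi>) (auto simp: Alt_simps)

text \<open>Paths through the moved quantifier are unchanged, by \<open>perp_prepend\<close> also
  when it leaves an antecedent and switches its kind; paths of the side formula receive a
  \<open>prepend\<close>.\<close>

lemma rhd_paths_le: "\<phi> \<rhd> \<psi> \<Longrightarrow> paths_le (Alt \<phi>) (Alt \<psi>)"
  by (induction rule: rhd.induct)
    (auto simp: Alt_simps image_Un image_image perp_prepend
      intro!: paths_le_Un paths_le_refl paths_le_prepend paths_le_prepend_image)

lemma step_paths_le: "step \<phi> \<psi> \<Longrightarrow> paths_le (Alt \<phi>) (Alt \<psi>)"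
  by (induction rule: step.induct)
    (auto simp: Alt_simps
      intro: rhd_paths_le paths_le_Un paths_le_refl paths_le_perp paths_le_prepend_mono)

lemma steps_paths_le: "step\<^sup>*\<^sup>* \<phi> \<psi> \<Longrightarrow> paths_le (Alt \<phi>) (Alt \<psi>)"
  by (induction rule: rtranclp_induct) (blast intro: paths_le_refl paths_le_trans step_paths_le)+

text \<open>By idempotence of \<open>prepend\<close> a nonempty block acts like a single
  quantifier.\<close>

lemma Alt_foldr_Exi: "xs \<noteq> [] \<Longrightarrow> Alt (foldr Exi xs \<phi>) = prepend Plus ` Alt \<phi>"
  by (induction xs rule: induct_list012) (simp_all add: Alt_Exi image_image)

lemma Alt_foldr_All: "xs \<noteq> [] \<Longrightarrow> Alt (foldr All xs \<phi>) = prepend Minus ` Alt \<phi>"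
  by (induction xs rule: induct_list012) (simp_all add: Alt_All image_image)

lemma Alt_Sigma_Pi:
  "(\<phi> \<in> Sigma_fm k \<longrightarrow> (\<forall>s\<in>Alt \<phi>. length s = k \<and> (s = [] \<or> init s = Some Plus))) \<and>
   (\<phi> \<in> Pi_fm k \<longrightarrow> (\<forall>s\<in>Alt \<phi>. length s = k \<and> (s = [] \<or> init s = Some Minus)))"
proof (induction k arbitrary: \<phi>)
  case 0
  then show ?case by (simp add: Alt_qfree)
next
  case (Suc k)
  \<comment> \<open>A path of the matrix is empty or starts with the opposite sign, so prepending
    really adds a symbol.\<close>
  have "length (prepend a s) = Suc k \<and> init (prepend a s) = Some a"
    if "length s = k" "s = [] \<or> init s = Some (flip a)" for a s
    using that by (cases a) (auto simp: prepend_def)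
  note prepend = this[of _ Plus] this[of _ Minus]
  show ?case
  proof (intro conjI impI)
    assume "\<phi> \<in> Sigma_fm (Suc k)"
    then obtain xs \<psi> where "\<phi> = foldr Exi xs \<psi>" "xs \<noteq> []" "\<psi> \<in> Pi_fm k" by auto
    with Suc[of \<psi>] prepend(1)
    show "\<forall>s\<in>Alt \<phi>. length s = Suc k \<and> (s = [] \<or> init s = Some Plus)"
      by (simp add: Alt_foldr_Exi)
  next
    assume "\<phi> \<in> Pi_fm (Suc k)"
    then obtain xs \<psi> where "\<phi> = foldr All xs \<psi>" "xs \<noteq> []" "\<psi> \<in> Sigma_fm k" by auto
    with Suc[of \<psi>] prepend(2)
    show "\<forall>s\<in>Alt \<phi>. length s = Suc k \<and> (s = [] \<or> init s = Some Minus)"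
      by (simp add: Alt_foldr_All)
  qed
qed

lemma Alt_Sigma_fm:
  "\<phi> \<in> Sigma_fm k \<Longrightarrow> s \<in> Alt \<phi> \<Longrightarrow> length s = k \<and> (s = [] \<or> init s = Some Plus)"
  using Alt_Sigma_Pi[of \<phi> k] by simp

lemma Alt_Pi_fm:
  "\<phi> \<in> Pi_fm k \<Longrightarrow> s \<in> Alt \<phi> \<Longrightarrow> length s = k \<and> (s = [] \<or> init s = Some Minus)"
  using Alt_Sigma_Pi[of \<phi> k] by simp

lemma Sigma_plus_path_bounded:
  "\<phi> \<in> Sigma_plus k \<Longrightarrow> s \<in> Alt \<phi> \<Longrightarrow> path_bounded Plus k s"
  by (auto simp: Sigma_plus_def path_bounded_def dest: Alt_Sigma_fm Alt_Pi_fm)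

lemma Pi_plus_path_bounded:
  "\<phi> \<in> Pi_plus k \<Longrightarrow> s \<in> Alt \<phi> \<Longrightarrow> path_bounded Minus k s"
  by (auto simp: Pi_plus_def path_bounded_def dest: Alt_Sigma_fm Alt_Pi_fm)

lemma deg_le_if_path_bounded:
  assumes "\<And>s. s \<in> Alt \<phi> \<Longrightarrow> path_bounded a k s"
  shows "deg \<phi> \<le> k"
proof -
  have "length s \<le> k" if "s \<in> Alt \<phi>" for s
    using assms[OF that] by (auto simp: path_bounded_def)
  then show ?thesis
    by (simp add: deg_def finite_Alt Alt_nonempty)
qed

lemma E_plus_if_path_bounded:
  assumes "\<And>s. s \<in> Alt \<phi> \<Longrightarrow> path_bounded Plus k s"
  shows "\<phi> \<in> E_plus k"
proof (cases "deg \<phi> < k")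
  case True
  then show ?thesis by (simp add: E_plus_def F_cls_def)
next
  case False
  then have "\<phi> \<in> F_cls k"
    using deg_le_if_path_bounded[of \<phi>, OF assms] by (simp add: F_cls_def)
  \<comment> \<open>For \<open>k\<close> nonzero a path of length \<open>k\<close> is not empty,
    which leaves only the sign alternative of the bound.\<close>
  moreover have "init s = Some Plus" if "s \<in> Alt \<phi>" "length s = k" "k \<noteq> 0" for s
    using assms[OF that(1)] that(2,3) by (auto simp: path_bounded_def)
  ultimately show ?thesis by (cases k) (simp_all add: E_plus_def)
qed

lemma U_plus_if_path_bounded:
  assumes "\<And>s. s \<in> Alt \<phi> \<Longrightarrow> path_bounded Minus k s"
  shows "\<phi> \<in> U_plus k"
proof (cases "deg \<phi> < k")
  case True
  then show ?thesis by (simp add: U_plus_def F_cls_def)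
next
  case False
  then have "\<phi> \<in> F_cls k"
    using deg_le_if_path_bounded[of \<phi>, OF assms] by (simp add: F_cls_def)
  moreover have "init s = Some Minus" if "s \<in> Alt \<phi>" "length s = k" "k \<noteq> 0" for s
    using assms[OF that(1)] that(2,3) by (auto simp: path_bounded_def)
  ultimately show ?thesis by (cases k) (simp_all add: U_plus_def)
qed

text \<open>Each path of the original formula lies below some path of the prenex form, and the bound
  is downward closed.\<close>

lemma path_bounded_if_PNF:
  assumes "\<psi> \<in> PNF \<phi>" and "\<And>t. t \<in> Alt \<psi> \<Longrightarrow> path_bounded a k t" and "s \<in> Alt \<phi>"
  shows "path_bounded a k s"
  using assms steps_paths_le path_bounded_downward unfolding PNF_def paths_le_def by blast

theorem theorem4p7:
  fixes L :: "('f, 'p) language" and k :: nat and \<phi> :: "('f, 'p) fm"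
  assumes "\<phi> \<in> formulas L"
  shows "(PNF \<phi> \<inter> Sigma_plus k \<noteq> {} \<longrightarrow> \<phi> \<in> E_plus k)
       \<and> (PNF \<phi> \<inter> Pi_plus k \<noteq> {} \<longrightarrow> \<phi> \<in> U_plus k)"
proof (intro conjI impI)
  assume "PNF \<phi> \<inter> Sigma_plus k \<noteq> {}"
  then obtain \<psi> where \<psi>: "\<psi> \<in> PNF \<phi>" "\<psi> \<in> Sigma_plus k" by blast
  show "\<phi> \<in> E_plus k"
    by (rule E_plus_if_path_bounded[OF path_bounded_if_PNF[OF \<psi>(1) Sigma_plus_path_bounded[OF \<psi>(2)]]])
next
  assume "PNF \<phi> \<inter> Pi_plus k \<noteq> {}"
  then obtain \<psi> where \<psi>: "\<psi> \<in> PNF \<phi>" "\<psi> \<in> Pi_plus k" by blast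
  show "\<phi> \<in> U_plus k"
    by (rule U_plus_if_path_bounded[OF path_bounded_if_PNF[OF \<psi>(1) Pi_plus_path_bounded[OF \<psi>(2)]]])
qed

end
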